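(* Consider the relaxed optimization problem: maximize $\sum_{i=1}^r\sum_{j=1}^r\bar a_i\lambda_iP_{ij}c_{ij}$ over $(\bar e,\bar f,\bar a)$ subject to $$\lambda_iP_{ij}\bar a_i=\mu_{ij}\bar f_{ij},\quad 1\le i,j\le r,$$ $$\mu_{ij}\bar e_{ij}\le\sum_{k=1}^r\mu_{ki}\bar f_{ki},\quad 1\le i\ne j\le r,$$ $$\sum_{k\ne i}\mu_{ki}\bar e_{ki}\le\lambda_i\bar a_i\le\sum_{k\ne i}\mu_{ki}\bar e_{ki}+\sum_{k=1}^r\mu_{ki}\bar f_{ki},\quad 1\le i\le r,$$ $$\lambda_i\bar a_i+\sum_{j\ne i}\mu_{ij}\bar e_{ij}=\sum_{k\ne i}\mu_{ki}\bar e_{ki}+\sum_{k=1}^r\mu_{ki}\bar f_{ki},\quad 1\le i\le r,$$ $$(\bar e,\bar f)\in\mathcal{T},\qquad 0\le\bar a_i\le1,\quad 1\le i\le r.$$ Let $(\bar e^*,\bar f^*,\bar a^* )$ be an optimal solution. 1. If $\bar a^*_i<1$ for all $1\le i\le r$, then $\bar e^*_{ii}=0$ for all $1\le i\le r$, implying that $(\bar e^*,\bar f^*,\bar a^* )$ also satisfies $(1-\bar a^*_i)\bar e^*_{ii}=0$ for all $1\le i\le r$. 2. Otherwise, choose any $i'$ such that $\bar a^*_{i'}=1$ and define $\tilde e$ by $\tilde e_{ij}=\bar e^*_{ij}$ for all $1\le i\ne j\le r$, $\tilde e_{i'i'}=\sum_{i=1}^r\bar e^*_{ii}$, and $\tilde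 e_{ii}=0$ for $i\ne i'$. Then $(\tilde e,\bar f^*,\bar a^* )$ is a feasible solution of the relaxed problem that yields the same objective value as $(\bar e^*,\bar f^*,\bar a^* )$ and also satisfies $(1-\bar a^*_i)\tilde e_{ii}=0$ for all $1\le i\le r$.
   Context: Here $r\ge1$ is an integer, $\lambda_i>0$, $\mu_{ij}>0$, $c_{ij}>0$ ($1\le i,j\le r$) are given reals, $P=(P_{ij})$ is a given $r\times r$ row-stochastic matrix, and $$\mathcal{T}=\Big\{(e,f)\in[0,1]^{r\times r}\times[0,1]^{r\times r}:\ \sum_{i=1}^r\sum_{j=1}^r(e_{ij}+f_{ij})=1\Big\}.$$ *)

theory Defs
  imports "HOL-Analysis.Analysis"
begin

text \<open>The index set \<open>{1,\<dots>,r}\<close> is the finite type \<open>'r\<close>, so \<open>r = CARD('r) \<ge> 1\<close>; an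
  \<open>r \<times> r\<close> matrix \<open>M\<close> has entries \<open>M $ i $ j\<close> (row \<open>i\<close>, column \<open>j\<close>).\<close>

definition row_stochastic :: "real^'r^'r \<Rightarrow> bool" where
  "row_stochastic P \<longleftrightarrow> (\<forall>i j. 0 \<le> P $ i $ j) \<and> (\<forall>i. (\<Sum>j\<in>UNIV. P $ i $ j) = 1)"

definition car_states :: "((real^'r^'r) \<times> (real^'r^'r)) set" where
  "car_states = {(e, f).
     (\<forall>i j. e $ i $ j \<in> {0..1}) \<and> (\<forall>i j. f $ i $ j \<in> {0..1}) \<and>
     (\<Sum>i\<in>UNIV. \<Sum>j\<in>UNIV. e $ i $ j + f $ i $ j) = 1}"

definition feasible ::
  "real^'r \<Rightarrow> real^'r^'r \<Rightarrow> real^'r^'r \<Rightarrow> (real^'r^'r) \<times> (real^'r^'r) \<times> (real^'r) \<Rightarrow> bool" where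
  "feasible lam mu P = (\<lambda>(e, f, a).
     (\<forall>i j. lam $ i * P $ i $ j * a $ i = mu $ i $ j * f $ i $ j) \<and>
     (\<forall>i j. i \<noteq> j \<longrightarrow> mu $ i $ j * e $ i $ j \<le> (\<Sum>k\<in>UNIV. mu $ k $ i * f $ k $ i)) \<and>
     (\<forall>i. (\<Sum>k\<in>UNIV - {i}. mu $ k $ i * e $ k $ i) \<le> lam $ i * a $ i \<and>
          lam $ i * a $ i \<le> (\<Sum>k\<in>UNIV - {i}. mu $ k $ i * e $ k $ i)
                          + (\<Sum>k\<in>UNIV. mu $ k $ i * f $ k $ i)) \<and>
     (\<forall>i. lam $ i * a $ i + (\<Sum>j\<in>UNIV - {i}. mu $ i $ j * e $ i $ j)
          = (\<Sum>k\<in>UNIV - {i}. mu $ k $ i * e $ k $ i) + (\<Sum>k\<in>UNIV. mu $ k $ i * f $ k $ i)) \<and>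
     (e, f) \<in> car_states \<and>
     (\<forall>i. 0 \<le> a $ i \<and> a $ i \<le> 1))"

definition objective ::
  "real^'r \<Rightarrow> real^'r^'r \<Rightarrow> real^'r^'r \<Rightarrow> (real^'r^'r) \<times> (real^'r^'r) \<times> (real^'r) \<Rightarrow> real" where
  "objective lam c P = (\<lambda>(e, f, a).
     \<Sum>i\<in>UNIV. \<Sum>j\<in>UNIV. a $ i * lam $ i * P $ i $ j * c $ i $ j)"

definition optimal ::
  "real^'r \<Rightarrow> real^'r^'r \<Rightarrow> real^'r^'r \<Rightarrow> real^'r^'r \<Rightarrow> (real^'r^'r) \<times> (real^'r^'r) \<times> (real^'r) \<Rightarrow> bool" where
  "optimal lam mu c P = is_arg_max (objective lam c P) (feasible lam mu P)"

definition move_diagonal :: "'r \<Rightarrow> real^'r^'r \<Rightarrow> real^'r^'r" where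
  "move_diagonal i' e = (\<chi> i j.
     if i \<noteq> j then e $ i $ j else if i = i' then (\<Sum>k\<in>UNIV. e $ k $ k) else 0)"

end

theory Submission
  imports Defs
begin

text \<open>The linear constraints do not involve the diagonal of \<open>e\<close>, and they define a convex cone in
  \<open>(e, f, a)\<close>. This cone contains a direction with \<open>\<lambda>\<^sub>i a\<^sub>i = 1\<close> for all \<open>i\<close>, along which the
  objective strictly increases: put \<open>\<mu>\<^sub>i\<^sub>j f\<^sub>i\<^sub>j = P\<^sub>i\<^sub>j\<close> and, with \<open>y\<^sub>i\<close> the \<open>i\<close>-th column sum of \<open>P\<close>,
  \<open>\<mu>\<^sub>i\<^sub>j e\<^sub>i\<^sub>j = y\<^sub>i / r\<close> for \<open>i \<noteq> j\<close>. If every \<open>a\<^sub>i < 1\<close> and some \<open>e\<^sub>i\<^sub>i > 0\<close>, a small step in this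
  direction, with the added mass taken away from \<open>e\<^sub>i\<^sub>i\<close>, stays feasible and contradicts optimality.
  In the other case only diagonal mass is moved.\<close>

definition flow_constraints ::
  "real^'r \<Rightarrow> real^'r^'r \<Rightarrow> real^'r^'r \<Rightarrow> real^'r^'r \<Rightarrow> real^'r^'r \<Rightarrow> real^'r \<Rightarrow> bool" where
  "flow_constraints lam mu P e f a \<longleftrightarrow>
     (\<forall>i j. lam $ i * P $ i $ j * a $ i = mu $ i $ j * f $ i $ j) \<and>
     (\<forall>i j. i \<noteq> j \<longrightarrow> mu $ i $ j * e $ i $ j \<le> (\<Sum>k\<in>UNIV. mu $ k $ i * f $ k $ i)) \<and>
     (\<forall>i. (\<Sum>k\<in>UNIV - {i}. mu $ k $ i * e $ k $ i) \<le> lam $ i * a $ i \<and>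
          lam $ i * a $ i \<le> (\<Sum>k\<in>UNIV - {i}. mu $ k $ i * e $ k $ i)
                          + (\<Sum>k\<in>UNIV. mu $ k $ i * f $ k $ i)) \<and>
     (\<forall>i. lam $ i * a $ i + (\<Sum>j\<in>UNIV - {i}. mu $ i $ j * e $ i $ j)
          = (\<Sum>k\<in>UNIV - {i}. mu $ k $ i * e $ k $ i) + (\<Sum>k\<in>UNIV. mu $ k $ i * f $ k $ i))"

text \<open>Separates the homogeneous linear part, which survives sums and nonnegative scaling, from
  the normalisation and the bounds on \<open>a\<close>, which must be rechecked after every
  perturbation.\<close>

lemma feasible_iff:
  "feasible lam mu P (e, f, a) \<longleftrightarrow>
     flow_constraints lam mu P e f a \<and> (e, f) \<in> car_states \<and> (\<forall>i. 0 \<le> a $ i \<and> a $ i \<le> 1)"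
  unfolding feasible_def flow_constraints_def by auto

text \<open>Every occurrence of \<open>e\<close> in the constraints has distinct indices, so
  diagonal mass can be redistributed freely.\<close>

lemma flow_constraints_offdiag_cong:
  assumes "\<And>i j. i \<noteq> j \<Longrightarrow> e' $ i $ j = e $ i $ j"
  shows "flow_constraints lam mu P e' f a \<longleftrightarrow> flow_constraints lam mu P e f a"
proof -
  have "(\<Sum>k\<in>UNIV - {i}. mu $ k $ i * e' $ k $ i) = (\<Sum>k\<in>UNIV - {i}. mu $ k $ i * e $ k $ i)" for i
    by (rule sum.cong) (auto simp: assms)
  moreover have "(\<Sum>j\<in>UNIV - {i}. mu $ i $ j * e' $ i $ j)
      = (\<Sum>j\<in>UNIV - {i}. mu $ i $ j * e $ i $ j)" for i
    by (rule sum.cong) (auto simp: assms)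
  ultimately show ?thesis
    by (simp add: flow_constraints_def assms)
qed

lemma flow_constraints_scale:
  assumes "flow_constraints lam mu P e f a" and "0 \<le> s"
  shows "flow_constraints lam mu P (s *\<^sub>R e) (s *\<^sub>R f) (s *\<^sub>R a)"
  using assms
  by (simp add: flow_constraints_def mult.left_commute[of _ s] mult_left_mono
      flip: sum_distrib_left distrib_left)

lemma flow_constraints_add:
  assumes "flow_constraints lam mu P e f a" and "flow_constraints lam mu P e' f' a'"
  shows "flow_constraints lam mu P (e + e') (f + f') (a + a')"
  using assms
  by (simp add: flow_constraints_def distrib_left sum.distrib add_mono) (smt (verit))

text \<open>Nonnegative entries with total mass 1 are automatically at most 1, so after a
  perturbation only signs and total mass need checking.\<close>

lemma car_states_iff:
  "(e, f) \<in> car_states \<longleftrightarrow>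
     (\<forall>i j. 0 \<le> e $ i $ j) \<and> (\<forall>i j. 0 \<le> f $ i $ j) \<and>
     (\<Sum>i\<in>UNIV. \<Sum>j\<in>UNIV. e $ i $ j + f $ i $ j) = 1" (is "_ \<longleftrightarrow> ?R")
proof
  assume R: ?R
  have "e $ i $ j + f $ i $ j \<le> 1" for i j
  proof -
    have "e $ i $ j + f $ i $ j \<le> (\<Sum>j\<in>UNIV. e $ i $ j + f $ i $ j)"
      using R by (intro member_le_sum) auto
    also have "\<dots> \<le> (\<Sum>i\<in>UNIV. \<Sum>j\<in>UNIV. e $ i $ j + f $ i $ j)"
      using R by (intro member_le_sum sum_nonneg) auto
    finally show ?thesis using R by simp
  qed
  then have "e $ i $ j \<le> 1 \<and> f $ i $ j \<le> 1" for i j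
    using R by (smt (verit))
  then show "(e, f) \<in> car_states" using R by (simp add: car_states_def)
qed (auto simp: car_states_def)

text \<open>The diagonal \<open>d\<close> stays free so that it can later absorb the change of total
  mass. Rows of \<open>P\<close> sum to 1, so the column sums \<open>y\<close> add up to r. This
  gives inflow \<open>1 - y i / r\<close> and outflow \<open>y i - y i / r\<close> of empty cars,
  and the balance reads \<open>1 + (y i - y i / r) = (1 - y i / r) + y i\<close>.\<close>

lemma flow_constraints_direction:
  fixes lam :: "real^'r" and mu P :: "real^'r^'r"
  assumes lam: "\<And>i. 0 < lam $ i" and mu: "\<And>i j. 0 < mu $ i $ j" and P: "row_stochastic P"
  shows "flow_constraints lam mu P
    (\<chi> i j. if i = j then d i else (\<Sum>k\<in>UNIV. P $ k $ i) / (CARD('r) * mu $ i $ j))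
    (\<chi> i j. P $ i $ j / mu $ i $ j) (\<chi> i. 1 / lam $ i)"
    (is "flow_constraints lam mu P ?e ?f ?a")
proof -
  define y where "y = (\<lambda>i. \<Sum>k\<in>UNIV. P $ k $ i)"
  let ?r = "real CARD('r)"
  have y0: "0 \<le> y i" for i
    using P by (auto simp: y_def row_stochastic_def intro: sum_nonneg)
  have r: "1 \<le> ?r"
    using finite_UNIV_card_ge_0[where 'a='r] by simp
  have "(\<Sum>i\<in>UNIV. y i) = (\<Sum>k\<in>UNIV. \<Sum>i\<in>UNIV. P $ k $ i)"
    unfolding y_def by (rule sum.swap)
  also have "\<dots> = ?r" using P by (simp add: row_stochastic_def)
  finally have sum_y: "(\<Sum>i\<in>UNIV. y i) = ?r" .
  have mu': "mu $ i $ j \<noteq> 0" for i j using mu[of i j] by simp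
  have lam': "lam $ i \<noteq> 0" for i using lam[of i] by simp
  have xf: "(\<Sum>k\<in>UNIV. mu $ k $ i * ?f $ k $ i) = y i" for i
    by (simp add: mu' y_def)
  have e: "mu $ i $ j * ?e $ i $ j = y i / ?r" if "i \<noteq> j" for i j
    using that by (simp add: mu' y_def)
  have inflow: "(\<Sum>k\<in>UNIV - {i}. mu $ k $ i * ?e $ k $ i) = 1 - y i / ?r" for i
  proof -
    have "(\<Sum>k\<in>UNIV - {i}. mu $ k $ i * ?e $ k $ i) = (\<Sum>k\<in>UNIV - {i}. y k / ?r)"
      by (rule sum.cong) (auto simp: e simp del: vec_lambda_beta)
    also have "\<dots> = (\<Sum>k\<in>UNIV. y k) / ?r - y i / ?r"
      by (simp add: sum_diff1 sum_divide_distrib)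
    finally show ?thesis using r by (simp add: sum_y)
  qed
  have outflow: "(\<Sum>j\<in>UNIV - {i}. mu $ i $ j * ?e $ i $ j) = y i - y i / ?r" for i
  proof -
    have "(\<Sum>j\<in>UNIV - {i}. mu $ i $ j * ?e $ i $ j) = (\<Sum>j\<in>UNIV - {i}. y i / ?r)"
      by (rule sum.cong) (auto simp: e simp del: vec_lambda_beta)
    also have "\<dots> = (\<Sum>j\<in>(UNIV :: 'r set). y i / ?r) - y i / ?r"
      by (subst sum_diff1) auto
    finally show ?thesis by simp
  qed
  \<comment> \<open>This yields both the bound on each \<open>mu $ i $ j * e $ i $ j\<close> and the
    upper bound \<open>1 \<le> 1 - y i / r + y i\<close>.\<close>
  have le: "y i / ?r \<le> y i" for i
    using r y0[of i] by (simp add: divide_le_eq mult_le_cancel_left1)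
  have a: "lam $ i * ?a $ i = 1" for i by (simp add: lam')
  have Pf: "lam $ i * P $ i $ j * ?a $ i = mu $ i $ j * ?f $ i $ j" for i j
    by (simp add: lam' mu')
  show ?thesis
    unfolding flow_constraints_def xf inflow outflow a
    using e le y0 r Pf by auto
qed

lemma objective_step:
  "objective lam c P (e + s *\<^sub>R e', f + s *\<^sub>R f', a + s *\<^sub>R a')
     = objective lam c P (e, f, a) + s * objective lam c P (e', f', a')"
  by (simp add: objective_def sum_distrib_left sum.distrib algebra_simps)

text \<open>The factors \<open>lam $ i\<close> cancel. Each row of \<open>P\<close> sums to 1 and
  hence has a positive entry, so with \<open>c\<close> positive every row contributes a positive
  amount.\<close>

lemma objective_direction_pos:
  assumes lam: "\<And>i. 0 < lam $ i" and c: "\<And>i j. 0 < c $ i $ j" and P: "row_stochastic P"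
  shows "0 < objective lam c P (e, f, \<chi> i. 1 / lam $ i)"
proof -
  have "0 < (\<Sum>j\<in>UNIV. P $ i $ j * c $ i $ j)" for i
  proof -
    obtain j where "0 < P $ i $ j"
      using P sum_nonpos[of UNIV "\<lambda>j. P $ i $ j"] unfolding row_stochastic_def
      by (metis UNIV_I linorder_not_less not_one_le_zero)
    then show ?thesis
      using P c by (intro sum_pos2[of _ j]) (auto simp: row_stochastic_def less_imp_le)
  qed
  then have "0 < (\<Sum>i\<in>UNIV. \<Sum>j\<in>UNIV. P $ i $ j * c $ i $ j)"
    by (rule sum_pos[rotated 2]) auto
  then show ?thesis
    using lam by (simp add: objective_def less_imp_neq[symmetric])
qed

lemma optimal_diagonal_zero:
  fixes lam :: "real^'r" and mu c P e f :: "real^'r^'r" and a :: "real^'r"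
  assumes lam: "\<And>i. 0 < lam $ i" and mu: "\<And>i j. 0 < mu $ i $ j" and c: "\<And>i j. 0 < c $ i $ j"
    and P: "row_stochastic P" and opt: "optimal lam mu c P (e, f, a)"
    and a1: "\<And>i. a $ i < 1"
  shows "e $ m $ m = 0"
proof (rule ccontr)
  assume nz: "e $ m $ m \<noteq> 0"
  have flow: "flow_constraints lam mu P e f a" and car: "(e, f) \<in> car_states"
    and a0: "\<And>i. 0 \<le> a $ i"
    using opt by (auto simp: optimal_def is_arg_max_def feasible_iff)
  have e0: "0 < e $ m $ m" using car nz by (auto simp: car_states_iff less_le)
  define E where "E = (\<lambda>d :: 'r \<Rightarrow> real. (\<chi> i j. if i = j then d i
     else (\<Sum>k\<in>UNIV. P $ k $ i) / (CARD('r) * mu $ i $ j)) :: real^'r^'r)"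
  define f' where "f' = (\<chi> i j. P $ i $ j / mu $ i $ j)"
  define a' where "a' = (\<chi> i. 1 / lam $ i)"
  \<comment> \<open>\<open>M\<close> is the mass of the direction with zero diagonal. Placing
    \<open>- M\<close> at position \<open>(m, m)\<close> makes the total mass of
    \<open>(e', f')\<close> zero.\<close>
  define M where "M = (\<Sum>i\<in>UNIV. \<Sum>j\<in>UNIV. E (\<lambda>_. 0) $ i $ j + f' $ i $ j)"
  define e' where "e' = E (\<lambda>i. if i = m then - M else 0)"
  have P0: "0 \<le> P $ i $ j" for i j using P by (simp add: row_stochastic_def)
  have f'0: "0 \<le> f' $ i $ j" for i j
    using P0 mu by (simp add: f'_def less_imp_le)
  \<comment> \<open>Only the entry at \<open>(m, m)\<close> can be negative, and there
    \<open>e\<close> has a positive reserve.\<close>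
  have e'0: "0 \<le> e' $ i $ j" if "(i, j) \<noteq> (m, m)" for i j
    using P0 mu[of i j] that by (auto simp: e'_def E_def intro!: divide_nonneg_nonneg sum_nonneg)
  have e'm: "e' $ m $ m = - M" by (simp add: e'_def E_def)
  have "e' $ i $ j = E (\<lambda>_. 0) $ i $ j - (if j = i then if i = m then M else 0 else 0)" for i j
    by (simp add: e'_def E_def)
  then have mass: "(\<Sum>i\<in>UNIV. \<Sum>j\<in>UNIV. e' $ i $ j + f' $ i $ j) = 0"
    by (simp add: M_def sum.distrib sum_subtractf)
  \<comment> \<open>The finitely many inequalities required are strict at \<open>s = 0\<close>, so
    by continuity they hold together for some small positive \<open>s\<close>.\<close>
  have "\<forall>\<^sub>F s in at_right 0. s * M < e $ m $ m"
    by (rule order_tendstoD(2)[OF _ e0]) (auto intro!: tendsto_eq_intros)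
  moreover have "\<forall>\<^sub>F s in at_right 0. \<forall>i. a $ i + s * a' $ i < 1"
    by (intro eventually_all_finite order_tendstoD(2)[OF _ a1]) (auto intro!: tendsto_eq_intros)
  moreover have "\<forall>\<^sub>F s in at_right (0::real). 0 < s"
    by (simp add: eventually_at_right_less)
  ultimately have "\<forall>\<^sub>F s in at_right 0. s * M < e $ m $ m \<and> (\<forall>i. a $ i + s * a' $ i < 1) \<and> 0 < s"
    by (intro eventually_conj)
  then obtain s where s: "0 < s" "s * M < e $ m $ m" "\<And>i. a $ i + s * a' $ i < 1"
    using eventually_happens'[OF trivial_limit_at_right_real] by blast
  have "flow_constraints lam mu P e' f' a'"
    unfolding e'_def E_def f'_def a'_def by (rule flow_constraints_direction[OF lam mu P])
  then have "flow_constraints lam mu P (e + s *\<^sub>R e') (f + s *\<^sub>R f') (a + s *\<^sub>R a')"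
    using flow s by (intro flow_constraints_add flow_constraints_scale) auto
  moreover have "(e + s *\<^sub>R e', f + s *\<^sub>R f') \<in> car_states"
  proof -
    \<comment> \<open>At \<open>(m, m)\<close> the entry is \<open>e $ m $ m - s * M\<close>,
      positive by the choice of \<open>s\<close>; elsewhere both summands are nonnegative.\<close>
    have "0 \<le> (e + s *\<^sub>R e') $ i $ j" for i j
      using s e'0[of i j] e'm car by (cases "(i, j) = (m, m)") (auto simp: car_states_iff)
    moreover have "(\<Sum>i\<in>UNIV. \<Sum>j\<in>UNIV. (e + s *\<^sub>R e') $ i $ j + (f + s *\<^sub>R f') $ i $ j)
      = (\<Sum>i\<in>UNIV. \<Sum>j\<in>UNIV. e $ i $ j + f $ i $ j)
        + s * (\<Sum>i\<in>UNIV. \<Sum>j\<in>UNIV. e' $ i $ j + f' $ i $ j)"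
      by (simp add: sum_distrib_left sum.distrib algebra_simps)
    ultimately show ?thesis
      using car mass s f'0 unfolding car_states_iff by simp
  qed
  moreover have "0 \<le> (a + s *\<^sub>R a') $ i \<and> (a + s *\<^sub>R a') $ i \<le> 1" for i
    using s(1) s(3)[of i] a0[of i] lam[of i] by (simp add: a'_def)
  ultimately have "feasible lam mu P (e + s *\<^sub>R e', f + s *\<^sub>R f', a + s *\<^sub>R a')"
    by (simp add: feasible_iff)
  moreover have "0 < s * objective lam c P (e', f', a')"
    using s objective_direction_pos[OF lam c P] by (simp add: a'_def)
  then have "objective lam c P (e, f, a)
      < objective lam c P (e + s *\<^sub>R e', f + s *\<^sub>R f', a + s *\<^sub>R a')"
    by (simp only: objective_step)
  ultimately show False
    using opt by (auto simp: optimal_def is_arg_max_def)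
qed

lemma car_states_move_diagonal:
  assumes "(e, f) \<in> car_states"
  shows "(move_diagonal m e, f) \<in> car_states"
proof -
  define D where "D = (\<Sum>k\<in>UNIV. e $ k $ k)"
  \<comment> \<open>As an additive correction on the diagonal, the move adds \<open>D\<close> once
    and removes the old diagonal, whose sum is \<open>D\<close>; the total mass is therefore
    unchanged.\<close>
  have eq: "move_diagonal m e $ i $ j
      = e $ i $ j + (if j = i then (if i = m then D else 0) - e $ i $ i else 0)" for i j
    by (simp add: move_diagonal_def D_def)
  have "(\<Sum>i\<in>UNIV. \<Sum>j\<in>UNIV. move_diagonal m e $ i $ j + f $ i $ j)
      = (\<Sum>i\<in>UNIV. \<Sum>j\<in>UNIV. e $ i $ j + f $ i $ j)"
    unfolding eq by (simp add: sum.distrib sum_subtractf D_def)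
  moreover have "0 \<le> move_diagonal m e $ i $ j" for i j
    using assms by (simp add: move_diagonal_def car_states_iff sum_nonneg)
  ultimately show ?thesis
    using assms by (simp add: car_states_iff)
qed

lemma feasible_move_diagonal:
  assumes "feasible lam mu P (e, f, a)"
  shows "feasible lam mu P (move_diagonal m e, f, a)"
proof -
  have "move_diagonal m e $ i $ j = e $ i $ j" if "i \<noteq> j" for i j
    using that by (simp add: move_diagonal_def)
  with assms show ?thesis
    using flow_constraints_offdiag_cong[of "move_diagonal m e" e]
    by (simp add: feasible_iff car_states_move_diagonal)
qed

theorem lemma2:
  fixes lam :: "real^'r" and mu c P :: "real^'r^'r"
    and e f :: "real^'r^'r" and a :: "real^'r"
  assumes "\<forall>i. 0 < lam $ i"
    and "\<forall>i j. 0 < mu $ i $ j"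
    and "\<forall>i j. 0 < c $ i $ j"
    and "row_stochastic P"
    and "optimal lam mu c P (e, f, a)"
  shows "((\<forall>i. a $ i < 1) \<longrightarrow>
            (\<forall>i. e $ i $ i = 0) \<and> (\<forall>i. (1 - a $ i) * e $ i $ i = 0)) \<and>
         (\<not> (\<forall>i. a $ i < 1) \<longrightarrow>
            (\<exists>i'. a $ i' = 1) \<and>
            (\<forall>i'. a $ i' = 1 \<longrightarrow>
               feasible lam mu P (move_diagonal i' e, f, a) \<and>
               objective lam c P (move_diagonal i' e, f, a) = objective lam c P (e, f, a) \<and>
               (\<forall>i. (1 - a $ i) * move_diagonal i' e $ i $ i = 0)))"
proof (intro conjI impI)
  assume "\<forall>i. a $ i < 1"
  with assms show "\<forall>i. e $ i $ i = 0"
    using optimal_diagonal_zero by blast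
  then show "\<forall>i. (1 - a $ i) * e $ i $ i = 0"
    by simp
next
  have feas: "feasible lam mu P (e, f, a)"
    using assms by (simp add: optimal_def is_arg_max_def)
  {
    assume "\<not> (\<forall>i. a $ i < 1)"
    with feas show "\<exists>i'. a $ i' = 1"
      by (metis feasible_iff less_le)
  }
  \<comment> \<open>Complementarity holds because the factor \<open>1 - a $ i\<close> vanishes at
    \<open>i'\<close> and the new diagonal vanishes everywhere else.\<close>
  show "\<forall>i'. a $ i' = 1 \<longrightarrow>
      feasible lam mu P (move_diagonal i' e, f, a) \<and>
      objective lam c P (move_diagonal i' e, f, a) = objective lam c P (e, f, a) \<and>
      (\<forall>i. (1 - a $ i) * move_diagonal i' e $ i $ i = 0)"
    using feasible_move_diagonal[OF feas] by (simp add: objective_def move_diagonal_def)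
qed

end
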